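(* Let $q$ be a complex number with $|q|\neq 0,1$, let $d\ge 1$, let $\boldsymbol{s}=(s_1,\ldots,s_d)\in\mathbb{Z}_{>0}^d$, and let $\boldsymbol{t}=(t_1,\ldots,t_d)$ be the variables of $R=\mathbb{C}[t_1,\ldots,t_d]$. Put $l(0)=0$, $l(i)=s_1+\cdots+s_i$ for $1\le i\le d$, and $w=l(d)$. Then for every integer $n\ge 1$ the following identity holds in $R_q[x,y]$: $$ \begin{aligned} M_n^{q}(\boldsymbol{s},\boldsymbol{t};x,y) =\sum_{n\ge n_1\ge\cdots\ge n_w\ge 1} \frac{(x+y)^{n-n_1}}{[n_1]\cdots[n_w]} &\left(\prod_{r=1}^{d-1} y^{\,n_{l(r-1)+1}-n_{l(r)}}\,(t_rx+y)^{\,n_{l(r)}-n_{l(r)+1}}\right)\\ &\times y^{\,n_{l(d-1)+1}-n_{l(d)}}\left((t_dx+y)^{n_{l(d)}}-y^{n_{l(d)}}\right), \end{aligned} $$ where the noncommutative product is ordered as $\prod_{j=1}^{v}X_j=X_1X_2\cdots X_v$ (an empty product being $1$), and all factors are multiplied in the order written.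
   Context: For an integer $n\ge 0$: $[n]=\frac{1-q^n}{1-q}=1+q+\cdots+q^{n-1}$; $[n]!=[n][n-1]\cdots[1]$ for $n\ge1$ and $[0]!=1$. The $q$-binomial coefficient is $\genfrac{[}{]}{0pt}{}{n}{k}=\frac{[n]!}{[k]!\,[n-k]!}$ for $n\ge k\ge 0$, and $0$ if $k>n$. $R_q[x,y]$ denotes the associative unital algebra over $R=\mathbb{C}[t_1,\ldots,t_d]$ generated by $x$ and $y$ subject to the relation $yx=q\,xy$ (the elements of $R$ are central). For $k\in\mathbb{Z}_{>0}$, define $$l_k^{\star,q}(\boldsymbol{s},\boldsymbol{t})=\sum_{k\ge n_1\ge\cdots\ge n_d\ge1}\frac{t_1^{n_1-n_2}\cdots t_{d-1}^{n_{d-1}-n_d}\,t_d^{n_d}}{[n_1]^{s_1}\cdots[n_d]^{s_d}}\in R,$$ and for $n\ge 0$ define $$M_n^{q}(\boldsymbol{s},\boldsymbol{t};x,y)=\sum_{k=1}^n\genfrac{[}{]}{0pt}{}{n}{k}x^ky^{n-k}\,l_k^{\star,q}(\boldsymbol{s},\boldsymbol{t})\in R_q[x,y].$$ *)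

theory Defs
  imports Complex_Main "HOL-Library.Poly_Mapping" "HOL-Algebra.QuotRing"
begin

section \<open>\<open>q\<close>-numbers\<close>

definition qint :: "complex \<Rightarrow> nat \<Rightarrow> complex" where
  "qint q n = (1 - q ^ n) / (1 - q)"

definition qfact :: "complex \<Rightarrow> nat \<Rightarrow> complex" where
  "qfact q n = (\<Prod>i=1..n. qint q i)"

definition qbinom :: "complex \<Rightarrow> nat \<Rightarrow> nat \<Rightarrow> complex" where
  "qbinom q n k = (if k \<le> n then qfact q n / (qfact q k * qfact q (n - k)) else 0)"


section \<open>The polynomial ring \<open>R = \<complex>[t\<^sub>1,\<dots>,t\<^sub>d]\<close>\<close>

text \<open>
  The type provides polynomials over the complex numbers in variables indexed by all natural
  numbers (a monomial is a finitely supported exponent function); \<open>poly_carrier d\<close> is the subring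
  of those in which only the variables with index \<open>1, \<dots>, d\<close> occur.
\<close>

type_synonym tpoly = "(nat \<Rightarrow>\<^sub>0 nat) \<Rightarrow>\<^sub>0 complex"

definition poly_carrier :: "nat \<Rightarrow> tpoly set" where
  "poly_carrier d = {p. \<forall>m \<in> Poly_Mapping.keys p. Poly_Mapping.keys m \<subseteq> {1..d}}"

definition tconst :: "complex \<Rightarrow> tpoly" where
  "tconst c = Poly_Mapping.single 0 c"

definition tvar :: "nat \<Rightarrow> tpoly" where
  "tvar i = Poly_Mapping.single (Poly_Mapping.single i 1) 1"


section \<open>The free algebra \<open>R\<langle>x,y\<rangle>\<close>\<close>

datatype letter = LX | LY

text \<open>The free monoid on the two letters, written additively because the convolution product of
  \<^type>\<open>poly_mapping\<close> is defined for additive monoids.\<close>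

datatype word = Word "letter list"

instantiation word :: monoid_add
begin

definition zero_word :: word where
  "0 = Word []"

fun plus_word :: "word \<Rightarrow> word \<Rightarrow> word" where
  "Word u + Word v = Word (u @ v)"

instance
proof
  fix a b c :: word
  show "a + b + c = a + (b + c)" by (cases a; cases b; cases c) simp
  show "0 + a = a" by (cases a) (simp add: zero_word_def)
  show "a + 0 = a" by (cases a) (simp add: zero_word_def)
qed

end

type_synonym fpoly = "word \<Rightarrow>\<^sub>0 tpoly"

definition free_alg :: "nat \<Rightarrow> fpoly ring" where
  "free_alg d =
    \<lparr>carrier = {f. \<forall>u. Poly_Mapping.lookup f u \<in> poly_carrier d},
     monoid.mult = (*), one = 1, zero = 0, add = (+)\<rparr>"

definition fconst :: "tpoly \<Rightarrow> fpoly" where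
  "fconst p = Poly_Mapping.single 0 p"

definition fletter :: "letter \<Rightarrow> fpoly" where
  "fletter a = Poly_Mapping.single (Word [a]) 1"


section \<open>The algebra \<open>R\<^sub>q[x,y] = R\<langle>x,y\<rangle> / (yx - q xy)\<close>\<close>

definition Rq_ideal :: "nat \<Rightarrow> complex \<Rightarrow> fpoly set" where
  "Rq_ideal d q = Idl\<^bsub>free_alg d\<^esub>
     {fletter LY * fletter LX - fconst (tconst q) * (fletter LX * fletter LY)}"

definition Rq :: "nat \<Rightarrow> complex \<Rightarrow> fpoly set ring" where
  "Rq d q = free_alg d Quot Rq_ideal d q"

definition Rq_class :: "nat \<Rightarrow> complex \<Rightarrow> fpoly \<Rightarrow> fpoly set" where
  "Rq_class d q f = Rq_ideal d q +>\<^bsub>free_alg d\<^esub> f"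

definition Rq_x :: "nat \<Rightarrow> complex \<Rightarrow> fpoly set" where
  "Rq_x d q = Rq_class d q (fletter LX)"

definition Rq_y :: "nat \<Rightarrow> complex \<Rightarrow> fpoly set" where
  "Rq_y d q = Rq_class d q (fletter LY)"

text \<open>The structure map \<open>R \<rightarrow> R\<^sub>q[x,y]\<close>.\<close>

definition Rq_scalar :: "nat \<Rightarrow> complex \<Rightarrow> tpoly \<Rightarrow> fpoly set" where
  "Rq_scalar d q p = Rq_class d q (fconst p)"

text \<open>The ordered product \<open>X\<^sub>1 X\<^sub>2 \<cdots> X\<^sub>v\<close>, equal to \<open>\<one>\<close> for the empty list.\<close>

definition ordered_prod :: "('a, 'b) monoid_scheme \<Rightarrow> 'a list \<Rightarrow> 'a" where
  "ordered_prod G Xs = foldr (monoid.mult G) Xs (one G)"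


section \<open>The sums \<open>l\<^sub>k\<close> and \<open>M\<^sub>n\<close>\<close>

text \<open>The tuples \<open>k \<ge> n\<^sub>1 \<ge> \<cdots> \<ge> n\<^sub>r \<ge> 1\<close>.\<close>

definition desc_tuples :: "nat \<Rightarrow> nat \<Rightarrow> (nat \<Rightarrow> nat) set" where
  "desc_tuples r k = {m \<in> {1..r} \<rightarrow>\<^sub>E {1..k}. \<forall>i\<in>{1..<r}. m (i + 1) \<le> m i}"

definition lstar ::
    "complex \<Rightarrow> nat \<Rightarrow> (nat \<Rightarrow> nat) \<Rightarrow> (nat \<Rightarrow> tpoly) \<Rightarrow> nat \<Rightarrow> tpoly" where
  "lstar q d s t k =
    (\<Sum>m\<in>desc_tuples d k.
       tconst (1 / (\<Prod>i=1..d. qint q (m i) ^ s i)) *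
       ((\<Prod>i\<in>{1..<d}. t i ^ (m i - m (i + 1))) * t d ^ m d))"

definition Mq ::
    "complex \<Rightarrow> nat \<Rightarrow> nat \<Rightarrow> (nat \<Rightarrow> nat) \<Rightarrow> (nat \<Rightarrow> tpoly) \<Rightarrow> fpoly set \<Rightarrow> fpoly set \<Rightarrow> fpoly set"
  where
  "Mq q d n s t x y =
    (\<Oplus>\<^bsub>Rq d q\<^esub>k\<in>{1..n}.
       Rq_scalar d q (tconst (qbinom q n k)) \<otimes>\<^bsub>Rq d q\<^esub>
       (x [^]\<^bsub>Rq d q\<^esub> k) \<otimes>\<^bsub>Rq d q\<^esub> (y [^]\<^bsub>Rq d q\<^esub> (n - k)) \<otimes>\<^bsub>Rq d q\<^esub>
       Rq_scalar d q (lstar q d s t k))"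


section \<open>Well-definedness\<close>

lemma poly_carrier_closed:
  "0 \<in> poly_carrier d" "1 \<in> poly_carrier d" "tconst c \<in> poly_carrier d"
  "i \<in> {1..d} \<Longrightarrow> tvar i \<in> poly_carrier d"
  "p \<in> poly_carrier d \<Longrightarrow> - p \<in> poly_carrier d"
  "p \<in> poly_carrier d \<Longrightarrow> p' \<in> poly_carrier d \<Longrightarrow> p + p' \<in> poly_carrier d"
  "p \<in> poly_carrier d \<Longrightarrow> p' \<in> poly_carrier d \<Longrightarrow> p * p' \<in> poly_carrier d"
proof -
  show "p + p' \<in> poly_carrier d" if "p \<in> poly_carrier d" "p' \<in> poly_carrier d"
    using that keys_add[of p p'] unfolding poly_carrier_def by blast
  show "p * p' \<in> poly_carrier d" if pp: "p \<in> poly_carrier d" "p' \<in> poly_carrier d"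
  proof -
    have "Poly_Mapping.keys m \<subseteq> {1..d}" if m: "m \<in> Poly_Mapping.keys (p * p')" for m
    proof -
      obtain a b where "a \<in> Poly_Mapping.keys p" "b \<in> Poly_Mapping.keys p'" "m = a + b"
        using m keys_mult[of p p'] by blast
      then show ?thesis
        using pp keys_add[of a b] unfolding poly_carrier_def by blast
    qed
    then show ?thesis unfolding poly_carrier_def by blast
  qed
qed (auto simp: poly_carrier_def tconst_def tvar_def single_one[symmetric] simp del: single_one
     split: if_splits)

lemma poly_carrier_sum:
  "(\<And>a. a \<in> A \<Longrightarrow> f a \<in> poly_carrier d) \<Longrightarrow> sum f A \<in> poly_carrier d"
  by (induction A rule: infinite_finite_induct) (auto simp: poly_carrier_closed)

lemma poly_carrier_prod:
  "(\<And>a. a \<in> A \<Longrightarrow> f a \<in> poly_carrier d) \<Longrightarrow> prod f A \<in> poly_carrier d"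
  by (induction A rule: infinite_finite_induct) (auto simp: poly_carrier_closed)

lemma poly_carrier_power: "p \<in> poly_carrier d \<Longrightarrow> p ^ n \<in> poly_carrier d"
  by (induction n) (auto simp: poly_carrier_closed)

lemma lstar_closed:
  assumes "d \<ge> 1" "\<And>i. i \<in> {1..d} \<Longrightarrow> t i \<in> poly_carrier d"
  shows "lstar q d s t k \<in> poly_carrier d"
  unfolding lstar_def using assms
  by (intro poly_carrier_sum poly_carrier_closed poly_carrier_prod poly_carrier_power) auto

lemma free_alg_mult_closed:
  assumes "f \<in> carrier (free_alg d)" "g \<in> carrier (free_alg d)"
  shows "f * g \<in> carrier (free_alg d)"
proof -
  have "Poly_Mapping.lookup (f * g) u \<in> poly_carrier d" for u
    using assms unfolding lookup_mult Sum_any.expand_set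
    by (intro poly_carrier_sum)
      (auto simp: free_alg_def when_def Sum_any.expand_set
        intro!: poly_carrier_closed poly_carrier_sum)
  then show ?thesis by (simp add: free_alg_def)
qed

lemma free_alg_closed:
  "1 \<in> carrier (free_alg d)"
  "p \<in> poly_carrier d \<Longrightarrow> fconst p \<in> carrier (free_alg d)"
  "fletter a \<in> carrier (free_alg d)"
  by (auto simp: free_alg_def fconst_def fletter_def lookup_single when_def lookup_one
      poly_carrier_closed)

lemma free_alg_ring: "ring (free_alg d)"
proof (rule ringI)
  show "abelian_group (free_alg d)"
  proof (rule abelian_groupI)
    fix f assume "f \<in> carrier (free_alg d)"
    then have "- f \<in> carrier (free_alg d)"
      by (simp add: free_alg_def poly_carrier_closed)
    then show "\<exists>g\<in>carrier (free_alg d). g \<oplus>\<^bsub>free_alg d\<^esub> f = \<zero>\<^bsub>free_alg d\<^esub>"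
      by (intro bexI[of _ "- f"]) (simp_all add: free_alg_def)
  qed (auto simp: free_alg_def lookup_add poly_carrier_closed add.assoc add.commute)
  show "Group.monoid (free_alg d)"
    by (rule monoidI)
      (use free_alg_mult_closed free_alg_closed in \<open>auto simp: free_alg_def mult.assoc\<close>)
qed (auto simp: free_alg_def algebra_simps)

lemma Rq_ideal_ideal: "ideal (Rq_ideal d q) (free_alg d)"
proof -
  interpret ring "free_alg d" by (rule free_alg_ring)
  have "f - g \<in> carrier (free_alg d)"
    if "f \<in> carrier (free_alg d)" "g \<in> carrier (free_alg d)" for f g
  proof -
    have "f + - g \<in> carrier (free_alg d)"
      using that by (simp add: free_alg_def lookup_add poly_carrier_closed del: add_uminus_conv_diff)
    then show ?thesis by simp
  qed
  then show ?thesis unfolding Rq_ideal_def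
    by (intro genideal_ideal)
      (simp add: free_alg_mult_closed free_alg_closed poly_carrier_closed)
qed

lemma Rq_ring: "ring (Rq d q)"
  unfolding Rq_def by (rule ideal.quotient_is_ring[OF Rq_ideal_ideal])

lemma Rq_class_hom: "Rq_class d q \<in> ring_hom (free_alg d) (Rq d q)"
  unfolding Rq_def Rq_class_def[abs_def] by (rule ideal.rcos_ring_hom[OF Rq_ideal_ideal])

lemma Rq_closed:
  "Rq_x d q \<in> carrier (Rq d q)" "Rq_y d q \<in> carrier (Rq d q)"
  "p \<in> poly_carrier d \<Longrightarrow> Rq_scalar d q p \<in> carrier (Rq d q)"
  unfolding Rq_x_def Rq_y_def Rq_scalar_def
  by (auto intro!: ring_hom_closed[OF Rq_class_hom] free_alg_closed)

lemma Rq_relation: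
  "Rq_y d q \<otimes>\<^bsub>Rq d q\<^esub> Rq_x d q =
   Rq_scalar d q (tconst q) \<otimes>\<^bsub>Rq d q\<^esub> (Rq_x d q \<otimes>\<^bsub>Rq d q\<^esub> Rq_y d q)"
proof -
  interpret F: ring "free_alg d" by (rule free_alg_ring)
  interpret I: ideal "Rq_ideal d q" "free_alg d" by (rule Rq_ideal_ideal)
  let ?a = "fletter LY * fletter LX" and ?b = "fconst (tconst q) * (fletter LX * fletter LY)"
  have ab: "?a \<in> carrier (free_alg d)" "?b \<in> carrier (free_alg d)"
    by (simp_all add: free_alg_mult_closed free_alg_closed poly_carrier_closed)
  have mult: "f \<otimes>\<^bsub>free_alg d\<^esub> g = f * g" and add: "f \<oplus>\<^bsub>free_alg d\<^esub> g = f + g" for f g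
    by (simp_all add: free_alg_def)
  have "- ?b \<in> carrier (free_alg d)"
    using ab by (simp add: free_alg_def poly_carrier_closed)
  then have "?a - ?b \<in> carrier (free_alg d)"
    using ab F.a_closed[of ?a "- ?b"] by (simp add: add)
  then have "?a - ?b \<in> Rq_ideal d q"
    unfolding Rq_ideal_def by (intro F.genideal_self') simp
  then have "?a \<in> Rq_ideal d q +>\<^bsub>free_alg d\<^esub> ?b"
    unfolding a_r_coset_def' by (intro UN_I[of "?a - ?b"]) (simp_all add: add)
  then have "Rq_class d q ?a = Rq_class d q ?b"
    unfolding Rq_class_def by (rule I.a_repr_independence'[OF _ ab(2), symmetric])
  then show ?thesis
    unfolding Rq_x_def Rq_y_def Rq_scalar_def
    by (simp add: ring_hom_mult[OF Rq_class_hom, symmetric] mult free_alg_closed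
        free_alg_mult_closed poly_carrier_closed)
qed

lemma Rq_scalar_central:
  assumes "p \<in> poly_carrier d" "z \<in> carrier (Rq d q)"
  shows "Rq_scalar d q p \<otimes>\<^bsub>Rq d q\<^esub> z = z \<otimes>\<^bsub>Rq d q\<^esub> Rq_scalar d q p"
proof -
  obtain f where f: "f \<in> carrier (free_alg d)" "z = Rq_class d q f"
    using assms(2) by (auto simp: Rq_def FactRing_def A_RCOSETS_def' Rq_class_def)
  have "(\<Sum>u\<in>Poly_Mapping.keys f. Poly_Mapping.single u (Poly_Mapping.lookup f u)) = f" (is "?S = f")
    by (rule poly_mapping_eqI)
      (auto simp: lookup_sum lookup_single when_def sum.delta in_keys_iff cong: if_cong)
  moreover have "fconst p * ?S = ?S * fconst p"
    by (simp add: fconst_def sum_distrib_left sum_distrib_right mult_single mult.commute)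
  ultimately have "fconst p * f = f * fconst p" by simp
  then have "fconst p \<otimes>\<^bsub>free_alg d\<^esub> f = f \<otimes>\<^bsub>free_alg d\<^esub> fconst p"
    by (simp add: free_alg_def)
  then show ?thesis
    unfolding Rq_scalar_def f(2)
    by (simp add: ring_hom_mult[OF Rq_class_hom, symmetric] f(1) free_alg_closed assms(1))
qed

lemma finite_desc_tuples: "finite (desc_tuples r k)"
proof -
  have "finite ({1..r} \<rightarrow>\<^sub>E {1..k} :: (nat \<Rightarrow> nat) set)" by (rule finite_PiE) auto
  then show ?thesis unfolding desc_tuples_def by (rule rev_finite_subset) auto
qed

end

theory Submission
  imports Defs
begin

text \<open>
  Let \<open>\<Phi>\<^sub>n(f) = \<Sum>\<^sub>k qbinom n k \<cdot> f(k) x\<^sup>k y\<^bsup>n-k\<^esup>\<close>. The \<open>q\<close>-Pascal rule and \<open>yx = q xy\<close> give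
  \<open>\<Phi>\<^bsub>n+1\<^esub>(f) = x \<Phi>\<^sub>n(f(\<cdot> + 1)) + y \<Phi>\<^sub>n(f)\<close>. Hence, if \<open>f(0) = g(0) = 0\<close> and
  \<open>g(k+1) = u g(k) + f(k+1) / [k+1]\<close>, that is \<open>g(k) = \<Sum>\<^bsub>1\<le>a\<le>k\<^esub> u\<^bsup>k-a\<^esup> f(a) / [a]\<close>, then by induction
  on \<open>n\<close> \<open>\<Phi>\<^sub>n(g) = \<Sum>\<^bsub>1\<le>a\<le>n\<^esub> (ux + y)\<^bsup>n-a\<^esup> \<Phi>\<^sub>a(f) / [a]\<close>. The left-hand side is \<open>\<Phi>\<^sub>n\<close> of the function
  \<open>k \<mapsto> l\<^sub>k\<close>, which arises from \<open>t\<^sub>d\<^sup>k\<close> (with value \<open>0\<close> at \<open>k = 0\<close>) by \<open>w\<close> such summations: \<open>u = 0\<close>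
  divides by \<open>[k]\<close> inside a block, \<open>u = t\<^sub>r\<close> joins block \<open>r\<close> to the next one, and \<open>u = 1\<close> is the
  outermost summation. All identities are computed in the free algebra modulo the defining ideal.
\<close>

section \<open>Congruence modulo the defining ideal\<close>

lemma fconst_hom:
  "fconst 0 = 0" "fconst 1 = 1" "fconst (p + p') = fconst p + fconst p'"
  "fconst (p * p') = fconst p * fconst p'"
  by (simp_all add: fconst_def single_add mult_single)

lemma tconst_hom:
  "tconst 0 = 0" "tconst 1 = 1" "tconst (a + b) = tconst a + tconst b"
  "tconst (a * b) = tconst a * tconst b"
  by (simp_all add: tconst_def single_add mult_single)

text \<open>Every element is the finite sum of its monomials. The constant sits on the empty word,
  which commutes with all words, and coefficients in \<open>R\<close> commute.\<close>

lemma fconst_central: "fconst p * f = f * fconst p"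
proof -
  have "(\<Sum>u\<in>Poly_Mapping.keys f. Poly_Mapping.single u (Poly_Mapping.lookup f u)) = f" (is "?S = f")
    by (rule poly_mapping_eqI)
      (auto simp: lookup_sum lookup_single when_def sum.delta in_keys_iff cong: if_cong)
  moreover have "fconst p * ?S = ?S * fconst p"
    by (simp add: fconst_def sum_distrib_left sum_distrib_right mult_single mult.commute)
  ultimately show ?thesis by simp
qed

lemma fconst_left_commute: "f * (fconst p * g) = fconst p * (f * g)"
  by (metis fconst_central mult.assoc)

text \<open>Restricted to letters and their powers, the rule is safe for rewriting; the general form
  would swap two constants forever.\<close>

lemmas fletter_fconst_left_commute =
  fconst_left_commute[of "fletter a" for a] fconst_left_commute[of "fletter a ^ k" for a k]

lemma fconst_mult_assoc: "fconst p * (fconst p' * f) = fconst (p * p') * f"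
  by (simp add: fconst_hom mult.assoc)

section \<open>The class map from the free algebra to the quotient\<close>

lemma free_alg_sel:
  "f \<otimes>\<^bsub>free_alg d\<^esub> g = f * g" "f \<oplus>\<^bsub>free_alg d\<^esub> g = f + g"
  "\<one>\<^bsub>free_alg d\<^esub> = 1" "\<zero>\<^bsub>free_alg d\<^esub> = 0"
  by (simp_all add: free_alg_def)

lemma free_alg_add_closed:
  "f \<in> carrier (free_alg d) \<Longrightarrow> g \<in> carrier (free_alg d) \<Longrightarrow> f + g \<in> carrier (free_alg d)"
  by (simp add: free_alg_def lookup_add poly_carrier_closed)

lemma free_alg_zero_closed: "0 \<in> carrier (free_alg d)"
  by (simp add: free_alg_def poly_carrier_closed)

lemma free_alg_minus_closed:
  "f \<in> carrier (free_alg d) \<Longrightarrow> - f \<in> carrier (free_alg d)"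
  by (simp add: free_alg_def poly_carrier_closed)

lemma free_alg_diff_closed:
  "f \<in> carrier (free_alg d) \<Longrightarrow> g \<in> carrier (free_alg d) \<Longrightarrow> f - g \<in> carrier (free_alg d)"
  using free_alg_add_closed[OF _ free_alg_minus_closed, of f d g] by simp

lemma free_alg_sum_closed:
  "(\<And>a. a \<in> A \<Longrightarrow> f a \<in> carrier (free_alg d)) \<Longrightarrow> sum f A \<in> carrier (free_alg d)"
  by (induction A rule: infinite_finite_induct)
    (auto simp: free_alg_add_closed free_alg_zero_closed)

lemma free_alg_power_closed: "f \<in> carrier (free_alg d) \<Longrightarrow> f ^ n \<in> carrier (free_alg d)"
  by (induction n) (auto simp: free_alg_closed free_alg_mult_closed)

lemma free_alg_prod_list_closed:
  "(\<And>f. f \<in> set fs \<Longrightarrow> f \<in> carrier (free_alg d)) \<Longrightarrow> prod_list fs \<in> carrier (free_alg d)"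
  by (induction fs) (auto simp: free_alg_closed free_alg_mult_closed)

lemmas free_alg_closure = free_alg_closed free_alg_mult_closed free_alg_add_closed
  free_alg_zero_closed free_alg_minus_closed free_alg_diff_closed free_alg_sum_closed
  free_alg_power_closed free_alg_prod_list_closed poly_carrier_closed

lemma Rq_class_add:
  assumes "f \<in> carrier (free_alg d)" "g \<in> carrier (free_alg d)"
  shows "Rq_class d q (f + g) = Rq_class d q f \<oplus>\<^bsub>Rq d q\<^esub> Rq_class d q g"
  using ring_hom_add[OF Rq_class_hom assms] by (simp add: free_alg_sel)

lemma Rq_class_mult:
  assumes "f \<in> carrier (free_alg d)" "g \<in> carrier (free_alg d)"
  shows "Rq_class d q (f * g) = Rq_class d q f \<otimes>\<^bsub>Rq d q\<^esub> Rq_class d q g"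
  using ring_hom_mult[OF Rq_class_hom assms] by (simp add: free_alg_sel)

lemma Rq_class_one: "Rq_class d q 1 = \<one>\<^bsub>Rq d q\<^esub>"
  using ring_hom_one[OF Rq_class_hom] by (simp add: free_alg_sel)

lemma Rq_class_closed: "f \<in> carrier (free_alg d) \<Longrightarrow> Rq_class d q f \<in> carrier (Rq d q)"
  by (rule ring_hom_closed[OF Rq_class_hom])

lemma Rq_class_zero: "Rq_class d q 0 = \<zero>\<^bsub>Rq d q\<^esub>"
  using ring_hom_zero[OF Rq_class_hom free_alg_ring Rq_ring] by (simp add: free_alg_sel)

lemma Rq_class_diff:
  assumes "f \<in> carrier (free_alg d)" "g \<in> carrier (free_alg d)"
  shows "Rq_class d q (f - g) = Rq_class d q f \<ominus>\<^bsub>Rq d q\<^esub> Rq_class d q g"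
proof -
  interpret ring "Rq d q" by (rule Rq_ring)
  have "Rq_class d q f = Rq_class d q (f - g) \<oplus>\<^bsub>Rq d q\<^esub> Rq_class d q g"
    using Rq_class_add[of "f - g" d g q] assms by (simp add: free_alg_diff_closed)
  then show ?thesis
    using assms by (simp add: Rq_class_closed free_alg_diff_closed a_minus_def a_assoc r_neg)
qed

lemma Rq_class_power:
  assumes "f \<in> carrier (free_alg d)"
  shows "Rq_class d q (f ^ n) = Rq_class d q f [^]\<^bsub>Rq d q\<^esub> n"
proof -
  interpret ring "Rq d q" by (rule Rq_ring)
  show ?thesis
    by (induction n)
      (simp_all add: Rq_class_one Rq_class_mult assms free_alg_power_closed power_Suc2 del: power_Suc)
qed

lemma Rq_class_sum:
  assumes "\<And>a. a \<in> A \<Longrightarrow> f a \<in> carrier (free_alg d)"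
  shows "Rq_class d q (\<Sum>a\<in>A. f a) = (\<Oplus>\<^bsub>Rq d q\<^esub>a\<in>A. Rq_class d q (f a))"
proof -
  interpret ring "Rq d q" by (rule Rq_ring)
  show ?thesis using assms
  proof (induction A rule: infinite_finite_induct)
    case (insert a A)
    then show ?case
      by (simp add: Rq_class_add free_alg_sum_closed Rq_class_closed Pi_def)
  qed (simp_all add: Rq_class_zero finsum_infinite)
qed

lemma Rq_class_prod_list:
  assumes "\<And>r. r \<in> set rs \<Longrightarrow> f r \<in> carrier (free_alg d)"
  shows "Rq_class d q (prod_list (map f rs)) = ordered_prod (Rq d q) (map (\<lambda>r. Rq_class d q (f r)) rs)"
  using assms
proof (induction rs)
  case (Cons r rs)
  have "prod_list (map f rs) \<in> carrier (free_alg d)"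
    by (rule free_alg_prod_list_closed) (use Cons.prems in auto)
  then show ?case using Cons by (simp add: ordered_prod_def Rq_class_mult)
qed (simp add: ordered_prod_def Rq_class_one)

text \<open>Membership in the carrier is part of the relation, so sums and products of congruences
  need no side conditions, and equalities can be proved by ordinary arithmetic in the type
  \<open>fpoly\<close>.\<close>

definition Rq_cong :: "nat \<Rightarrow> complex \<Rightarrow> fpoly \<Rightarrow> fpoly \<Rightarrow> bool" where
  "Rq_cong d q f g \<longleftrightarrow> f \<in> carrier (free_alg d) \<and> g \<in> carrier (free_alg d) \<and>
     Rq_class d q f = Rq_class d q g"

lemma Rq_cong_refl: "f \<in> carrier (free_alg d) \<Longrightarrow> Rq_cong d q f f"
  by (simp add: Rq_cong_def)

lemma Rq_cong_sym: "Rq_cong d q f g \<Longrightarrow> Rq_cong d q g f"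
  by (simp add: Rq_cong_def)

lemma Rq_cong_trans [trans]: "Rq_cong d q f g \<Longrightarrow> Rq_cong d q g h \<Longrightarrow> Rq_cong d q f h"
  by (simp add: Rq_cong_def)

lemma Rq_cong_add:
  "Rq_cong d q f g \<Longrightarrow> Rq_cong d q f' g' \<Longrightarrow> Rq_cong d q (f + f') (g + g')"
  by (simp add: Rq_cong_def Rq_class_add free_alg_add_closed)

lemma Rq_cong_mult:
  "Rq_cong d q f g \<Longrightarrow> Rq_cong d q f' g' \<Longrightarrow> Rq_cong d q (f * f') (g * g')"
  by (simp add: Rq_cong_def Rq_class_mult free_alg_mult_closed)

lemma Rq_cong_sum:
  "(\<And>a. a \<in> A \<Longrightarrow> Rq_cong d q (f a) (g a)) \<Longrightarrow> Rq_cong d q (sum f A) (sum g A)"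
  by (induction A rule: infinite_finite_induct)
    (auto simp: Rq_cong_add Rq_cong_refl free_alg_zero_closed)

text \<open>The letter \<open>y\<close> passes one \<open>x\<close> at a time, and each exchange
  costs one factor \<open>q\<close>.\<close>

lemma Rq_cong_commute_power:
  "Rq_cong d q (fletter LY * fletter LX ^ k) (fconst (tconst (q ^ k)) * (fletter LX ^ k * fletter LY))"
proof (induction k)
  case 0
  show ?case by (simp add: fconst_hom tconst_hom Rq_cong_refl free_alg_closed)
next
  case (Suc k)
  let ?x = "fletter LX" and ?y = "fletter LY"
  have rel: "Rq_cong d q (?y * ?x) (fconst (tconst q) * (?x * ?y))"
    using Rq_relation[of d q] unfolding Rq_x_def Rq_y_def Rq_scalar_def
    by (simp add: Rq_cong_def Rq_class_mult free_alg_closure)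
  have "?y * ?x ^ Suc k = (?y * ?x) * ?x ^ k"
    by (simp add: mult.assoc)
  also have "Rq_cong d q \<dots> (fconst (tconst q) * (?x * ?y) * ?x ^ k)"
    by (intro Rq_cong_mult rel Rq_cong_refl free_alg_closure)
  also have "fconst (tconst q) * (?x * ?y) * ?x ^ k = fconst (tconst q) * ?x * (?y * ?x ^ k)"
    by (simp add: mult.assoc)
  also have "Rq_cong d q \<dots> (fconst (tconst q) * ?x * (fconst (tconst (q ^ k)) * (?x ^ k * ?y)))"
    by (intro Rq_cong_mult Suc Rq_cong_refl free_alg_closure)
  also have "\<dots> = fconst (tconst (q ^ Suc k)) * (?x ^ Suc k * ?y)"
    by (simp add: fconst_mult_assoc tconst_hom mult.assoc fletter_fconst_left_commute)
  finally show ?case .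
qed

section \<open>\<open>q\<close>-binomial coefficients\<close>

text \<open>Since \<open>norm q\<close> differs from 1, \<open>q\<close> is not a root of
  unity.\<close>

lemma qint_nonzero:
  assumes "norm q \<noteq> 1" "n \<ge> 1"
  shows "qint q n \<noteq> 0"
proof -
  have "q ^ n \<noteq> 1"
    using assms power_eq_1_iff[of q n] by auto
  moreover have "q \<noteq> 1" using assms by auto
  ultimately show ?thesis by (auto simp: qint_def)
qed

lemma qfact_nonzero: "norm q \<noteq> 1 \<Longrightarrow> qfact q n \<noteq> 0"
  by (simp add: qfact_def qint_nonzero)

lemma qfact_Suc: "qfact q (Suc n) = qfact q n * qint q (Suc n)"
  by (simp add: qfact_def)

lemma qbinom_0: "norm q \<noteq> 1 \<Longrightarrow> qbinom q n 0 = 1"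
  using qfact_nonzero[of q n] by (simp add: qbinom_def qfact_def[of _ 0])

text \<open>The absorption identity. It will turn division by [k] under the transform into division
  by [n] in front of it.\<close>

lemma qbinom_Suc_absorb:
  assumes "norm q \<noteq> 1"
  shows "qint q (Suc k) * qbinom q (Suc n) (Suc k) = qint q (Suc n) * qbinom q n k"
  using qint_nonzero[OF assms, of "Suc k"]
  by (simp add: qbinom_def qfact_Suc)

lemma qint_add: "q \<noteq> 1 \<Longrightarrow> qint q (m + n) = qint q m + q ^ m * qint q n"
  by (simp add: qint_def divide_simps) (simp add: algebra_simps power_add)

text \<open>This is the form of the \<open>q\<close>-Pascal rule whose factor
  \<open>q ^ Suc k\<close> matches the cost of moving \<open>y\<close> past
  \<open>x ^ Suc k\<close>. It comes from [n+1] = [k+1] + \<open>q ^ Suc k\<close> [n-k].\<close>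

lemma qbinom_Suc_Suc:
  assumes "norm q \<noteq> 1"
  shows "qbinom q (Suc n) (Suc k) = qbinom q n k + q ^ Suc k * qbinom q n (Suc k)"
proof -
  note nz = qint_nonzero[OF assms] qfact_nonzero[OF assms]
  consider "n < k" | "n = k" | "n > k" by linarith
  then show ?thesis
  proof cases
    case 3
    then obtain j where j: "n = Suc (k + j)"
      using less_imp_Suc_add by blast
    have q: "q \<noteq> 1" using assms by auto
    have "qint q (Suc n) = qint q (Suc k) + q ^ Suc k * qint q (Suc j)"
      using qint_add[OF q, of "Suc k" "Suc j"] by (simp add: j)
    moreover have "n - k = Suc j" "n - Suc k = j" using j by simp_all
    \<comment> \<open>Here \<open>a\<close> is \<open>qfact q n\<close>, \<open>b\<close> and
      \<open>c\<close> are the \<open>q\<close>-numbers of \<open>Suc k\<close> and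
      \<open>Suc j\<close>, \<open>fk\<close> and \<open>fj\<close> are the factorials of
      \<open>k\<close> and \<open>j\<close>, and \<open>Q\<close> is
      \<open>q ^ Suc k\<close>.\<close>
    moreover have "a * (b + Q * c) / ((fk * b) * (fj * c)) = a / (fk * (fj * c)) + Q * (a / ((fk * b) * fj))"
      if "b \<noteq> 0" "c \<noteq> 0" "fk \<noteq> 0" "fj \<noteq> 0" for a b c fk fj Q :: complex
      using that by (simp add: field_simps)
    ultimately show ?thesis
      using nz(1)[of "Suc k"] nz(1)[of "Suc j"] nz(2)[of k] nz(2)[of j] 3
      by (simp add: qbinom_def qfact_Suc del: power_Suc)
  qed (use nz in \<open>auto simp: qbinom_def qfact_def[of _ 0]\<close>)
qed

section \<open>The \<open>q\<close>-binomial transform\<close>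

text \<open>Unlike in \<open>Mq\<close>, the sum includes \<open>k = 0\<close>. This makes the
  recursion in \<open>n\<close> close up, and the functions that represent \<open>Mq\<close> must
  therefore vanish at 0.\<close>

definition qtransform :: "complex \<Rightarrow> nat \<Rightarrow> (nat \<Rightarrow> tpoly) \<Rightarrow> fpoly" where
  "qtransform q n f =
     (\<Sum>k\<le>n. fconst (tconst (qbinom q n k) * f k) * (fletter LX ^ k * fletter LY ^ (n - k)))"

lemma qtransform_closed:
  "(\<And>k. f k \<in> poly_carrier d) \<Longrightarrow> qtransform q n f \<in> carrier (free_alg d)"
  unfolding qtransform_def by (intro free_alg_closure)

lemma qtransform_linear:
  "qtransform q n (\<lambda>k. u * f k + g k) = fconst u * qtransform q n f + qtransform q n g"
proof -
  have "fconst (c * (u * f k + g k)) = fconst u * fconst (c * f k) + fconst (c * g k)" for c k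
    by (simp add: fconst_hom[symmetric] algebra_simps)
  then show ?thesis
    by (simp add: qtransform_def sum_distrib_left sum.distrib[symmetric] distrib_right mult.assoc)
qed

text \<open>By the \<open>q\<close>-Pascal rule the coefficients split in two. The first summand
  gives \<open>x\<close> times the transform of the shifted function; the \<open>q\<close>-power in
  the second is absorbed by pulling one \<open>y\<close> to the front.\<close>

lemma qtransform_Suc:
  assumes q: "norm q \<noteq> 1" and f: "\<And>k. f k \<in> poly_carrier d"
  shows "Rq_cong d q (qtransform q (Suc n) f)
    (fletter LX * qtransform q n (\<lambda>k. f (Suc k)) + fletter LY * qtransform q n f)"
proof -
  let ?x = "fletter LX" and ?y = "fletter LY"
  let ?b = "\<lambda>n k. tconst (qbinom q n k)"
  let ?Y = "\<lambda>k. fconst (?b n k * f k) * ((fconst (tconst (q ^ k)) * (?x ^ k * ?y)) * ?y ^ (n - k))"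
  have Y: "?y * qtransform q n f = (\<Sum>k\<le>n. fconst (?b n k * f k) * ((?y * ?x ^ k) * ?y ^ (n - k)))"
    unfolding qtransform_def by (simp add: sum_distrib_left fletter_fconst_left_commute mult.assoc)
  have cong: "Rq_cong d q (\<Sum>k\<le>n. ?Y k) (?y * qtransform q n f)"
    unfolding Y
    by (intro Rq_cong_sum Rq_cong_mult Rq_cong_commute_power[THEN Rq_cong_sym] Rq_cong_refl
        free_alg_closure f)
  have "?Y k = fconst (?b n k * tconst (q ^ k) * f k) * (?x ^ k * ?y ^ (Suc n - k))" if "k \<le> n" for k
    using that by (simp add: Suc_diff_le fconst_mult_assoc mult.assoc) (simp add: mult.left_commute mult.commute)
  then have "(\<Sum>k\<le>n. ?Y k) = (\<Sum>k\<le>n. fconst (?b n k * tconst (q ^ k) * f k) * (?x ^ k * ?y ^ (Suc n - k)))"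
    by (intro sum.cong) auto
  \<comment> \<open>The added term \<open>k = Suc n\<close> is zero because
    \<open>qbinom q n (Suc n) = 0\<close>. With it, splitting off \<open>k = 0\<close> leaves a sum
    over the same range as the \<open>x\<close> part.\<close>
  also have "\<dots> = (\<Sum>k\<le>Suc n. fconst (?b n k * tconst (q ^ k) * f k) * (?x ^ k * ?y ^ (Suc n - k)))"
    by (simp add: qbinom_def tconst_hom fconst_hom)
  also have "\<dots> = fconst (f 0) * ?y ^ Suc n +
      (\<Sum>k\<le>n. fconst (?b n (Suc k) * tconst (q ^ Suc k) * f (Suc k)) * (?x ^ Suc k * ?y ^ (n - k)))"
    by (subst sum.atMost_Suc_shift) (simp add: qbinom_0[OF q] tconst_hom)
  finally have Y': "(\<Sum>k\<le>n. ?Y k) = \<dots>" .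
  have X: "?x * qtransform q n (\<lambda>k. f (Suc k)) =
      (\<Sum>k\<le>n. fconst (?b n k * f (Suc k)) * (?x ^ Suc k * ?y ^ (n - k)))"
    unfolding qtransform_def by (simp add: sum_distrib_left fletter_fconst_left_commute mult.assoc)
  have "qtransform q (Suc n) f = fconst (f 0) * ?y ^ Suc n +
      (\<Sum>k\<le>n. fconst (?b (Suc n) (Suc k) * f (Suc k)) * (?x ^ Suc k * ?y ^ (n - k)))"
    unfolding qtransform_def by (subst sum.atMost_Suc_shift) (simp add: qbinom_0[OF q] tconst_hom)
  also have "\<dots> = ?x * qtransform q n (\<lambda>k. f (Suc k)) + (\<Sum>k\<le>n. ?Y k)"
    unfolding X Y' qbinom_Suc_Suc[OF q]
    by (simp add: tconst_hom fconst_hom algebra_simps sum.distrib)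
  also have "Rq_cong d q \<dots> (?x * qtransform q n (\<lambda>k. f (Suc k)) + ?y * qtransform q n f)"
    by (intro Rq_cong_add cong Rq_cong_refl free_alg_closure qtransform_closed f)
  finally show ?thesis .
qed

text \<open>Absorption, applied termwise. The term \<open>k = 0\<close> of the transform at
  \<open>Suc n\<close> has no counterpart on the left, and \<open>f 0 = 0\<close> removes
  it.\<close>

lemma qtransform_div_qint:
  assumes q: "norm q \<noteq> 1" and f: "f 0 = 0"
  shows "fletter LX * qtransform q n (\<lambda>k. tconst (1 / qint q (Suc k)) * f (Suc k)) =
    fconst (tconst (1 / qint q (Suc n))) * qtransform q (Suc n) f"
proof -
  have "tconst (qbinom q n k) * tconst (1 / qint q (Suc k)) =
      tconst (1 / qint q (Suc n)) * tconst (qbinom q (Suc n) (Suc k))" for k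
  proof -
    have "qbinom q n k * (1 / qint q (Suc k)) = 1 / qint q (Suc n) * qbinom q (Suc n) (Suc k)"
      using qbinom_Suc_absorb[OF q, of k n] qint_nonzero[OF q, of "Suc k"]
        qint_nonzero[OF q, of "Suc n"]
      by (simp add: frac_eq_eq mult.commute)
    then show ?thesis by (metis tconst_hom(4))
  qed
  then show ?thesis
    unfolding qtransform_def sum.atMost_Suc_shift using f
    by (simp add: fconst_hom(1) sum_distrib_left fletter_fconst_left_commute fconst_mult_assoc
        mult.assoc[symmetric]) (simp add: mult.assoc fletter_fconst_left_commute fconst_mult_assoc)
qed

lemma qtransform_0: "norm q \<noteq> 1 \<Longrightarrow> qtransform q 0 f = fconst (f 0)"
  by (simp add: qtransform_def qbinom_0 tconst_hom)

text \<open>Inserting \<open>g_Suc\<close> into the recursion yields \<open>u x + y\<close> times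
  the transform of \<open>g\<close> at \<open>n\<close>, plus the new term \<open>a = Suc n\<close>.
  The left multiplication raises every earlier exponent \<open>n - a\<close> by one.\<close>

lemma qtransform_step:
  assumes q: "norm q \<noteq> 1" and u: "u \<in> poly_carrier d"
    and f: "\<And>k. f k \<in> poly_carrier d" "f 0 = 0" and g: "\<And>k. g k \<in> poly_carrier d" "g 0 = 0"
    and g_Suc: "\<And>k. g (Suc k) = u * g k + tconst (1 / qint q (Suc k)) * f (Suc k)"
  shows "Rq_cong d q (qtransform q n g)
    (\<Sum>a=1..n. fconst (tconst (1 / qint q a)) *
       ((fconst u * fletter LX + fletter LY) ^ (n - a) * qtransform q a f))"
proof (induction n)
  case 0
  show ?case by (simp add: qtransform_0[OF q] g fconst_hom Rq_cong_refl free_alg_closure)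
next
  case (Suc n)
  let ?z = "fconst u * fletter LX + fletter LY"
  let ?c = "\<lambda>a. fconst (tconst (1 / qint q a))"
  have "Rq_cong d q (qtransform q (Suc n) g)
      (fletter LX * qtransform q n (\<lambda>k. g (Suc k)) + fletter LY * qtransform q n g)"
    by (rule qtransform_Suc[OF q g(1)])
  also have "\<dots> = ?z * qtransform q n g + ?c (Suc n) * qtransform q (Suc n) f"
    unfolding g_Suc qtransform_linear qtransform_div_qint[where f = f, OF q f(2), symmetric]
    by (simp add: distrib_left distrib_right mult.assoc fletter_fconst_left_commute)
  also have "Rq_cong d q \<dots> (?z * (\<Sum>a=1..n. ?c a * (?z ^ (n - a) * qtransform q a f))
      + ?c (Suc n) * qtransform q (Suc n) f)"
    by (intro Rq_cong_add Rq_cong_mult Suc Rq_cong_refl free_alg_closure qtransform_closed f u)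
  also have "?z * (\<Sum>a=1..n. ?c a * (?z ^ (n - a) * qtransform q a f)) =
      (\<Sum>a=1..n. ?c a * (?z ^ (Suc n - a) * qtransform q a f))"
    unfolding sum_distrib_left
  proof (intro sum.cong refl)
    fix a assume "a \<in> {1..n}"
    then have "?z ^ (Suc n - a) = ?z * ?z ^ (n - a)" by (simp add: Suc_diff_le)
    then show "?z * (?c a * (?z ^ (n - a) * qtransform q a f)) =
        ?c a * (?z ^ (Suc n - a) * qtransform q a f)"
      by (simp add: fconst_left_commute[of ?z] mult.assoc)
  qed
  finally show ?case by simp
qed

text \<open>The \<open>q\<close>-binomial theorem for \<open>u x + y\<close>: on powers of
  \<open>u\<close> the shift is multiplication by \<open>u\<close>, so the recursion is left
  multiplication by \<open>u x + y\<close>.\<close>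

lemma qtransform_power:
  assumes q: "norm q \<noteq> 1" and u: "u \<in> poly_carrier d"
  shows "Rq_cong d q (qtransform q n (\<lambda>k. u ^ k)) ((fconst u * fletter LX + fletter LY) ^ n)"
proof (induction n)
  case 0
  show ?case by (simp add: qtransform_0[OF q] fconst_hom Rq_cong_refl free_alg_closure)
next
  case (Suc n)
  let ?x = "fletter LX" and ?y = "fletter LY"
  have "Rq_cong d q (qtransform q (Suc n) (\<lambda>k. u ^ k))
      (?x * qtransform q n (\<lambda>k. u ^ Suc k) + ?y * qtransform q n (\<lambda>k. u ^ k))"
    by (rule qtransform_Suc[OF q]) (rule poly_carrier_power[OF u])
  also have "qtransform q n (\<lambda>k. u ^ Suc k) = fconst u * qtransform q n (\<lambda>k. u ^ k)"
    using qtransform_linear[of q n u "\<lambda>k. u ^ k" "\<lambda>k. 0"]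
    by (simp add: qtransform_def[of _ _ "\<lambda>_. 0"] fconst_hom)
  also have "?x * (fconst u * qtransform q n (\<lambda>k. u ^ k)) + ?y * qtransform q n (\<lambda>k. u ^ k) =
      (fconst u * ?x + ?y) * qtransform q n (\<lambda>k. u ^ k)"
    by (simp add: distrib_right mult.assoc fletter_fconst_left_commute)
  also have "Rq_cong d q \<dots> ((fconst u * ?x + ?y) * (fconst u * ?x + ?y) ^ n)"
    by (intro Rq_cong_mult Suc Rq_cong_refl free_alg_closure u)
  finally show ?case by simp
qed

text \<open>This produces the final difference of powers in the theorem: suppressing the value at 0
  removes exactly the term \<open>y ^ n\<close>.\<close>

lemma qtransform_power_pos:
  assumes q: "norm q \<noteq> 1" and u: "u \<in> poly_carrier d"
  shows "Rq_cong d q (qtransform q n (\<lambda>k. if k = 0 then 0 else u ^ k))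
    ((fconst u * fletter LX + fletter LY) ^ n - fletter LY ^ n)"
proof -
  let ?x = "fletter LX" and ?y = "fletter LY"
  have delta: "qtransform q n (\<lambda>k. if k = 0 then 1 else 0) = ?y ^ n"
  proof -
    have "qtransform q n (\<lambda>k. if k = 0 then 1 else 0) =
        (\<Sum>k\<le>n. if k = 0 then ?y ^ n else 0)"
      unfolding qtransform_def
      by (intro sum.cong) (auto simp: qbinom_0[OF q] tconst_hom fconst_hom)
    then show ?thesis by simp
  qed
  \<comment> \<open>Subtracting the indicator of 0, whose transform is \<open>y ^ n\<close>, is
    written in the shape that \<open>qtransform_linear\<close> expects.\<close>
  have "(\<lambda>k. if k = 0 then 0 else u ^ k) = (\<lambda>k. (-1) * (if k = 0 then 1 else 0) + u ^ k)"
    by auto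
  then have "qtransform q n (\<lambda>k. if k = 0 then 0 else u ^ k) =
      fconst (-1) * ?y ^ n + qtransform q n (\<lambda>k. u ^ k)"
    unfolding delta[symmetric] by (simp only: qtransform_linear)
  also have "Rq_cong d q \<dots> (fconst (-1) * ?y ^ n + (fconst u * ?x + ?y) ^ n)"
    by (intro Rq_cong_add qtransform_power q u Rq_cong_refl free_alg_closure)
  also have "fconst (-1) = - 1"
    by (simp add: fconst_def single_uminus)
  finally show ?thesis by simp
qed


section \<open>Sums over weakly decreasing tuples\<close>

text \<open>The value \<open>undefined\<close> outside the index range is made explicit, so that a
  tuple changed at one index can be checked pointwise.\<close>

lemma desc_tuples_iff:
  "m \<in> desc_tuples r k \<longleftrightarrow> (\<forall>i. 1 \<le> i \<and> i \<le> r \<longrightarrow> 1 \<le> m i \<and> m i \<le> k) \<and>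
     (\<forall>i. i = 0 \<or> r < i \<longrightarrow> m i = undefined) \<and> (\<forall>i. 1 \<le> i \<and> i < r \<longrightarrow> m (Suc i) \<le> m i)"
  unfolding desc_tuples_def PiE_def extensional_def by (auto simp: Pi_iff not_le Suc_le_eq)

lemma desc_tuples_antimono:
  assumes "m \<in> desc_tuples r k" "1 \<le> i" "i \<le> j" "j \<le> r"
  shows "m j \<le> m i"
  using assms(3,4)
proof (induction j rule: dec_induct)
  case (step j)
  then have "m (j + 1) \<le> m j" using assms(1,2) by (auto simp: desc_tuples_def)
  with step show ?case by simp
qed simp

lemma sum_desc_tuples_1: "(\<Sum>m\<in>desc_tuples (Suc 0) k. F (m 1)) = (\<Sum>a=1..k. F a)"
proof (rule sum.reindex_bij_witness[where j = "\<lambda>m. m 1" and i = "\<lambda>a. (\<lambda>_. undefined)(1 := a)"])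
  fix m assume m: "m \<in> desc_tuples (Suc 0) k"
  have "m i = undefined" if "i \<noteq> 1" for i
  proof -
    have "i = 0 \<or> Suc 0 < i" using that by linarith
    then show ?thesis using m by (auto simp: desc_tuples_iff)
  qed
  then show "(\<lambda>_. undefined)(1 := m 1) = m" by auto
qed (auto simp: desc_tuples_iff)

text \<open>The last entry is split off as an innermost sum, whose only upper bound is the entry
  before it.\<close>

lemma sum_desc_tuples_Suc:
  assumes "r \<ge> 1"
  shows "(\<Sum>m\<in>desc_tuples (Suc r) k. F m) =
    (\<Sum>m\<in>desc_tuples r k. \<Sum>a=1..m r. F (m(Suc r := a)))"
proof -
  have "(\<Sum>m\<in>desc_tuples (Suc r) k. F m) =
      (\<Sum>p\<in>(SIGMA m:desc_tuples r k. {1..m r}). F ((fst p)(Suc r := snd p)))"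
  \<comment> \<open>Resetting index \<open>Suc r\<close> to \<open>undefined\<close> makes the
    shortened function extensional again, hence a tuple of length \<open>r\<close>.\<close>
  proof (rule sum.reindex_bij_witness[where j = "\<lambda>m. (m(Suc r := undefined), m (Suc r))"
        and i = "\<lambda>p. (fst p)(Suc r := snd p)"])
    fix m assume m: "m \<in> desc_tuples (Suc r) k"
    then have "m (Suc r) \<le> m r" "m (Suc r) \<ge> 1"
      using assms by (auto simp: desc_tuples_def)
    with m show "(m(Suc r := undefined), m (Suc r)) \<in> (SIGMA m:desc_tuples r k. {1..m r})"
      by (auto simp: desc_tuples_iff split: if_splits)
  next
    fix p assume p: "p \<in> (SIGMA m:desc_tuples r k. {1..m r})"
    obtain m a where [simp]: "p = (m, a)" by (cases p)
    have m: "m \<in> desc_tuples r k" and a: "1 \<le> a" "a \<le> m r" using p by auto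
    have "m r \<le> k" using m assms by (auto simp: desc_tuples_def)
    with m a show "(fst p)(Suc r := snd p) \<in> desc_tuples (Suc r) k"
      by (auto simp: desc_tuples_iff less_Suc_eq split: if_splits)
    have "m (Suc r) = undefined" using m by (auto simp: desc_tuples_iff)
    then have "m(Suc r := undefined) = m" by (metis fun_upd_triv)
    then show "(((fst p)(Suc r := snd p))(Suc r := undefined), ((fst p)(Suc r := snd p)) (Suc r)) = p"
      by simp
  qed auto
  also have "\<dots> = (\<Sum>m\<in>desc_tuples r k. \<Sum>a=1..m r. F (m(Suc r := a)))"
    by (subst sum.Sigma) (auto simp: finite_desc_tuples case_prod_unfold)
  finally show ?thesis .
qed

section \<open>Expansion of the transform of \<open>lstar\<close>\<close>

text \<open>\<open>lstar_tail q d s t r k\<close> is the sum over the inner variables \<open>n\<^bsub>r+1\<^esub>, \<dots>, n\<^sub>d\<close> alone, with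
  \<open>n\<^sub>r = k\<close> and the convention \<open>t\<^sub>0 = 1\<close>; it is \<open>0\<close> at \<open>k = 0\<close>.\<close>

function lstar_tail ::
    "complex \<Rightarrow> nat \<Rightarrow> (nat \<Rightarrow> nat) \<Rightarrow> (nat \<Rightarrow> tpoly) \<Rightarrow> nat \<Rightarrow> nat \<Rightarrow> tpoly" where
  "lstar_tail q d s t r k =
    (if r < d then
       (\<Sum>a=1..k. (if r = 0 then 1 else t r) ^ (k - a) *
          (tconst (1 / qint q a ^ s (Suc r)) * lstar_tail q d s t (Suc r) a))
     else if k = 0 then 0 else t d ^ k)"
  by auto
termination by (relation "measure (\<lambda>(q, d, s, t, r, k). d - r)") auto

declare lstar_tail.simps [simp del]

lemma lstar_tail_0: "lstar_tail q d s t r 0 = 0"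
  by (subst lstar_tail.simps) simp

text \<open>The summand \<open>a = Suc k\<close> has exponent 0, and all others gain one factor.
  This is the recursion to which \<open>qtransform_step\<close> applies.\<close>

lemma lstar_tail_Suc:
  assumes "r < d"
  shows "lstar_tail q d s t r (Suc k) = (if r = 0 then 1 else t r) * lstar_tail q d s t r k +
    tconst (1 / qint q (Suc k) ^ s (Suc r)) * lstar_tail q d s t (Suc r) (Suc k)"
proof -
  let ?u = "if r = 0 then 1 else t r"
  let ?F = "\<lambda>a. tconst (1 / qint q a ^ s (Suc r)) * lstar_tail q d s t (Suc r) a"
  have tail: "lstar_tail q d s t r k = (\<Sum>a=1..k. ?u ^ (k - a) * ?F a)" for k
    using assms by (subst lstar_tail.simps) simp
  have "(\<Sum>a=1..k. ?u ^ (Suc k - a) * ?F a) = ?u * (\<Sum>a=1..k. ?u ^ (k - a) * ?F a)"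
    unfolding sum_distrib_left by (intro sum.cong refl) (simp add: Suc_diff_le mult.assoc)
  then show ?thesis unfolding tail by simp
qed

lemma lstar_tail_closed:
  assumes "d \<ge> 1" "\<And>i. i \<in> {1..d} \<Longrightarrow> t i \<in> poly_carrier d"
  shows "lstar_tail q d s t r k \<in> poly_carrier d"
  using assms
proof (induction q d s t r k rule: lstar_tail.induct)
  case (1 q d s t r k)
  show ?case
  proof (cases "r < d")
    case True
    then have "(if r = 0 then 1 else t r) \<in> poly_carrier d"
      using 1(3)[of r] by (auto simp: poly_carrier_closed)
    then show ?thesis
      by (subst lstar_tail.simps, subst if_P[OF True])
        (intro poly_carrier_sum poly_carrier_closed poly_carrier_power 1(1)[OF True _ 1(2,3)])
  next
    case False
    then show ?thesis using 1(2,3)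
      by (subst lstar_tail.simps) (auto intro!: poly_carrier_closed poly_carrier_power)
  qed
qed

text \<open>Unfolding the tail once more appends an entry to the tuple. For \<open>r = 1\<close> the
  power of the base is invisible since the base is 1.\<close>

lemma lstar_tail_eq_sum:
  assumes "1 \<le> r" "r \<le> d"
  shows "lstar_tail q d s t 0 k =
    (\<Sum>m\<in>desc_tuples r k. tconst (1 / (\<Prod>i=1..r. qint q (m i) ^ s i)) *
       ((\<Prod>i\<in>{1..<r}. t i ^ (m i - m (i + 1))) * lstar_tail q d s t r (m r)))"
  using assms
proof (induction r rule: dec_induct)
  case base
  then show ?case
    by (subst lstar_tail.simps)
      (simp add: sum_desc_tuples_1[where F = "\<lambda>a. tconst (1 / qint q a ^ s (Suc 0)) *
          lstar_tail q d s t (Suc 0) a", simplified])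
next
  case (step r)
  let ?c = "\<lambda>r m. tconst (1 / (\<Prod>i=1..r. qint q (m i) ^ s i))"
  let ?p = "\<lambda>r m. \<Prod>i\<in>{1..<r}. t i ^ (m i - m (i + 1))"
  have "?c r m * (?p r m * lstar_tail q d s t r (m r)) =
      (\<Sum>a=1..m r. ?c (Suc r) (m(Suc r := a)) *
        (?p (Suc r) (m(Suc r := a)) * lstar_tail q d s t (Suc r) a))" for m
  proof -
    have "?c (Suc r) (m(Suc r := a)) = ?c r m * tconst (1 / qint q a ^ s (Suc r))" for a
    proof -
      have "(\<Prod>i=1..r. qint q ((m(Suc r := a)) i) ^ s i) = (\<Prod>i=1..r. qint q (m i) ^ s i)"
        by (intro prod.cong) auto
      then show ?thesis by (simp add: tconst_hom(4)[symmetric])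
    qed
    moreover have "?p (Suc r) (m(Suc r := a)) = ?p r m * t r ^ (m r - a)" for a
    proof -
      have "?p r (m(Suc r := a)) = ?p r m" by (intro prod.cong) auto
      then show ?thesis using step.hyps by (simp add: prod.atLeastLessThan_Suc)
    qed
    moreover have "lstar_tail q d s t r (m r) = (\<Sum>a=1..m r. t r ^ (m r - a) *
        (tconst (1 / qint q a ^ s (Suc r)) * lstar_tail q d s t (Suc r) a))"
      using step by (subst lstar_tail.simps) simp
    ultimately show ?thesis
      by (simp only: sum_distrib_left) (simp only: mult.assoc mult.left_commute)
  qed
  then show ?case
    using step by (simp add: sum_desc_tuples_Suc)
qed

lemma lstar_tail_eq_lstar:
  assumes "d \<ge> 1"
  shows "lstar_tail q d s t 0 k = lstar q d s t k"
proof -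
  \<comment> \<open>Entries of a tuple are at least 1, so the default value at 0 does not
    occur.\<close>
  have "lstar_tail q d s t d (m d) = t d ^ m d" if "m \<in> desc_tuples d k" for m
    using that assms by (subst lstar_tail.simps) (auto simp: desc_tuples_iff)
  then show ?thesis
    unfolding lstar_tail_eq_sum[OF assms order_refl] lstar_def by (intro sum.cong) auto
qed

section \<open>Iterated summation inside sums over tuples\<close>

text \<open>\<open>qtransform_step\<close> is applied under the sum, and its summation variable
  becomes entry \<open>Suc N\<close>. For this the accumulated factor \<open>Q\<close> must not
  depend on that entry.\<close>

lemma qtransform_desc_tuples_step:
  assumes q: "norm q \<noteq> 1" and u: "u \<in> poly_carrier d"
    and f: "\<And>k. f k \<in> poly_carrier d" "f 0 = 0" and g: "\<And>k. g k \<in> poly_carrier d" "g 0 = 0"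
    and g_Suc: "\<And>k. g (Suc k) = u * g k + tconst (1 / qint q (Suc k)) * f (Suc k)"
    and N: "N \<ge> 1"
    and Q: "\<And>m. m \<in> desc_tuples N n \<Longrightarrow> Q m \<in> carrier (free_alg d)"
      "\<And>m a. m \<in> desc_tuples N n \<Longrightarrow> Q (m(Suc N := a)) = Q m"
    and h: "Rq_cong d q h (\<Sum>m\<in>desc_tuples N n. Q m * qtransform q (m N) g)"
  shows "Rq_cong d q h
    (\<Sum>m\<in>desc_tuples (Suc N) n. Q m * (fconst (tconst (1 / qint q (m (Suc N)))) *
       ((fconst u * fletter LX + fletter LY) ^ (m N - m (Suc N)) * qtransform q (m (Suc N)) f)))"
proof -
  let ?z = "fconst u * fletter LX + fletter LY"
  have "Rq_cong d q (\<Sum>m\<in>desc_tuples N n. Q m * qtransform q (m N) g)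
    (\<Sum>m\<in>desc_tuples N n. Q m * (\<Sum>a=1..m N. fconst (tconst (1 / qint q a)) *
      (?z ^ (m N - a) * qtransform q a f)))"
    by (intro Rq_cong_sum Rq_cong_mult Rq_cong_refl Q qtransform_step q u f g g_Suc)
  also have "\<dots> = (\<Sum>m\<in>desc_tuples (Suc N) n. Q m * (fconst (tconst (1 / qint q (m (Suc N)))) *
       (?z ^ (m N - m (Suc N)) * qtransform q (m (Suc N)) f)))"
    unfolding sum_desc_tuples_Suc[OF N] sum_distrib_left
    by (intro sum.cong refl) (simp add: Q)
  finally show ?thesis using h by (rule Rq_cong_trans[rotated])
qed

text \<open>The factors of the right-hand side that involve only the first \<open>N\<close> variables, where \<open>N\<close>
  lies in the \<open>r\<close>-th block, \<open>l(r-1) < N \<le> l(r)\<close>.\<close>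

definition block_prefix ::
    "complex \<Rightarrow> (nat \<Rightarrow> nat) \<Rightarrow> (nat \<Rightarrow> tpoly) \<Rightarrow> nat \<Rightarrow> nat \<Rightarrow> nat \<Rightarrow> (nat \<Rightarrow> nat) \<Rightarrow> fpoly" where
  "block_prefix q l t n r N m =
     fconst (tconst (1 / (\<Prod>j=1..N. qint q (m j)))) * (fletter LX + fletter LY) ^ (n - m 1) *
     prod_list (map (\<lambda>r. fletter LY ^ (m (l (r - 1) + 1) - m (l r)) *
       (fconst (t r) * fletter LX + fletter LY) ^ (m (l r) - m (l r + 1))) [1..<r]) *
     fletter LY ^ (m (l (r - 1) + 1) - m N)"

lemma block_prefix_closed:
  assumes "\<And>i. i \<in> {1..<r} \<Longrightarrow> t i \<in> poly_carrier d"
  shows "block_prefix q l t n r N m \<in> carrier (free_alg d)"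
  unfolding block_prefix_def
  by (intro free_alg_closure) (auto intro!: free_alg_closure assms)

text \<open>All entries that are read have index at most \<open>N\<close>: the completed blocks end
  at or before \<open>l (r - 1) < N\<close>, so even the index one further is at most
  \<open>N\<close>.\<close>

lemma block_prefix_upd:
  assumes "mono l" "l (r - 1) < N"
  shows "block_prefix q l t n r N (m(Suc N := a)) = block_prefix q l t n r N m"
proof -
  have prod: "(\<Prod>j=1..N. qint q ((m(Suc N := a)) j)) = (\<Prod>j=1..N. qint q (m j))"
    by (intro prod.cong) auto
  have l: "l i < N" if "i < r" for i
    using monoD[OF assms(1), of i "r - 1"] assms(2) that by linarith
  have factors: "map (\<lambda>r. fletter LY ^ ((m(Suc N := a)) (l (r - 1) + 1) - (m(Suc N := a)) (l r)) *
       (fconst (t r) * fletter LX + fletter LY) ^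
         ((m(Suc N := a)) (l r) - (m(Suc N := a)) (l r + 1))) [1..<r] =
     map (\<lambda>r. fletter LY ^ (m (l (r - 1) + 1) - m (l r)) *
       (fconst (t r) * fletter LX + fletter LY) ^ (m (l r) - m (l r + 1))) [1..<r]"
  proof (intro map_cong refl)
    fix i assume "i \<in> set [1..<r]"
    then have "l (i - 1) < N" "l i < N" by (auto intro!: l)
    then show "fletter LY ^ ((m(Suc N := a)) (l (i - 1) + 1) - (m(Suc N := a)) (l i)) *
        (fconst (t i) * fletter LX + fletter LY) ^
          ((m(Suc N := a)) (l i) - (m(Suc N := a)) (l i + 1)) =
      fletter LY ^ (m (l (i - 1) + 1) - m (l i)) *
        (fconst (t i) * fletter LX + fletter LY) ^ (m (l i) - m (l i + 1))"
      by simp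
  qed
  have upd: "(m(Suc N := a)) 1 = m 1" "(m(Suc N := a)) (l (r - 1) + 1) = m (l (r - 1) + 1)"
    "(m(Suc N := a)) N = m N"
    using assms(2) by auto
  show ?thesis unfolding block_prefix_def prod factors upd ..
qed

text \<open>The powers of \<open>y\<close> within a block telescope. Truncated subtraction is exact
  here because the tuple is weakly decreasing.\<close>

lemma block_prefix_next_in_block:
  assumes "m \<in> desc_tuples (Suc N) n" "l (r - 1) < N"
  shows "block_prefix q l t n r (Suc N) m =
    block_prefix q l t n r N m *
      (fconst (tconst (1 / qint q (m (Suc N)))) * fletter LY ^ (m N - m (Suc N)))"
proof -
  have "m (Suc N) \<le> m N" "m N \<le> m (l (r - 1) + 1)"
    using assms by (auto intro!: desc_tuples_antimono[OF assms(1)])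
  then have "fletter LY ^ (m (l (r - 1) + 1) - m (Suc N)) =
      fletter LY ^ (m (l (r - 1) + 1) - m N) * fletter LY ^ (m N - m (Suc N))"
    by (simp add: power_add[symmetric])
  moreover have "fconst (tconst (1 / (\<Prod>j=1..Suc N. qint q (m j)))) =
      fconst (tconst (1 / qint q (m (Suc N)))) * fconst (tconst (1 / (\<Prod>j=1..N. qint q (m j))))"
    by (simp add: fconst_hom(4)[symmetric] tconst_hom(4)[symmetric] mult.commute)
  ultimately show ?thesis
    unfolding block_prefix_def
    by (simp only: mult.assoc
        fconst_left_commute[of _ "tconst (1 / qint q (m (Suc N)))"])
qed

text \<open>The trailing power of \<open>y\<close> and the new power of \<open>t r x + y\<close>
  together form the list factor of block \<open>r\<close>. The new block has length one so far, and
  its own trailing power is \<open>y ^ 0\<close>.\<close>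

lemma block_prefix_next_block:
  assumes "1 \<le> r"
  shows "block_prefix q l t n (Suc r) (Suc (l r)) m =
    block_prefix q l t n r (l r) m * (fconst (tconst (1 / qint q (m (Suc (l r))))) *
      (fconst (t r) * fletter LX + fletter LY) ^ (m (l r) - m (Suc (l r))))"
proof -
  have "fconst (tconst (1 / (\<Prod>j=1..Suc N. qint q (m j)))) =
      fconst (tconst (1 / qint q (m (Suc N)))) * fconst (tconst (1 / (\<Prod>j=1..N. qint q (m j))))" for N
    by (simp add: fconst_hom(4)[symmetric] tconst_hom(4)[symmetric] mult.commute)
  then show ?thesis
    unfolding block_prefix_def using assms
    by (simp add: mult.assoc fconst_left_commute[of _ "tconst (1 / qint q (m (Suc (l r))))"])
qed

lemma tconst_inverse_power:
  "j < k \<Longrightarrow> tconst (1 / c ^ (k - j)) = tconst (1 / c) * tconst (1 / c ^ (k - Suc j))"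
  by (simp add: tconst_hom(4)[symmetric] Suc_diff_Suc[symmetric] del: Suc_diff_Suc)

text \<open>Each remaining division by [a] is a summation with \<open>u = 0\<close>, so
  \<open>u x + y\<close> reduces to \<open>y\<close> and only the prefix grows.\<close>

lemma qtransform_lstar_within_block:
  assumes l: "mono l" and q: "norm q \<noteq> 1" and d: "d \<ge> 1" and t: "\<And>i. i \<in> {1..d} \<Longrightarrow> t i \<in> poly_carrier d"
    and r: "1 \<le> r" "r \<le> d" and i: "1 \<le> i" "i \<le> s r"
    and start: "Rq_cong d q h (\<Sum>m\<in>desc_tuples (l (r - 1) + 1) n.
      block_prefix q l t n r (l (r - 1) + 1) m * qtransform q (m (l (r - 1) + 1))
        (\<lambda>a. tconst (1 / qint q a ^ (s r - 1)) * lstar_tail q d s t r a))"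
  shows "Rq_cong d q h (\<Sum>m\<in>desc_tuples (l (r - 1) + i) n.
      block_prefix q l t n r (l (r - 1) + i) m * qtransform q (m (l (r - 1) + i))
        (\<lambda>a. tconst (1 / qint q a ^ (s r - i)) * lstar_tail q d s t r a))"
  using i
proof (induction i rule: dec_induct)
  case base
  show ?case by (rule start)
next
  case (step i)
  let ?N = "l (r - 1) + i"
  let ?h = "\<lambda>i a. tconst (1 / qint q a ^ (s r - i)) * lstar_tail q d s t r a"
  have h: "?h i k \<in> poly_carrier d" for i k
    by (intro poly_carrier_closed lstar_tail_closed d t)
  have "Rq_cong d q h (\<Sum>m\<in>desc_tuples (Suc ?N) n. block_prefix q l t n r ?N m *
      (fconst (tconst (1 / qint q (m (Suc ?N)))) *
       ((fconst 0 * fletter LX + fletter LY) ^ (m ?N - m (Suc ?N)) *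
         qtransform q (m (Suc ?N)) (?h (Suc i)))))"
  proof (rule qtransform_desc_tuples_step[OF q, where g = "?h i"])
    show "?h i (Suc k) = 0 * ?h i k + tconst (1 / qint q (Suc k)) * ?h (Suc i) (Suc k)" for k
      using step by (simp add: tconst_inverse_power mult.assoc)
    show "block_prefix q l t n r ?N (m(Suc ?N := a)) = block_prefix q l t n r ?N m" for m a
      using step l by (intro block_prefix_upd) auto
    show "block_prefix q l t n r ?N m \<in> carrier (free_alg d)" for m
      using r by (intro block_prefix_closed t) auto
  qed (use step h in \<open>auto simp: poly_carrier_closed lstar_tail_0\<close>)
  also have "\<dots> = (\<Sum>m\<in>desc_tuples (Suc ?N) n. block_prefix q l t n r (Suc ?N) m *
      qtransform q (m (Suc ?N)) (?h (Suc i)))"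
    using step by (intro sum.cong refl)
      (simp add: block_prefix_next_in_block fconst_hom(1) mult.assoc)
  finally show ?case by simp
qed

text \<open>A block is opened by one summation, with \<open>u = 1\<close> for the first block and
  \<open>u = t r\<close> when passing from block \<open>r\<close> to the next. It is then completed
  by the divisions with \<open>u = 0\<close>.\<close>

lemma qtransform_lstar_blocks:
  fixes s :: "nat \<Rightarrow> nat"
  defines "l \<equiv> \<lambda>i. \<Sum>j=1..i. s j"
  assumes q: "norm q \<noteq> 1" and t: "\<And>i. i \<in> {1..d} \<Longrightarrow> t i \<in> poly_carrier d"
    and s: "\<And>i. i \<in> {1..d} \<Longrightarrow> s i > 0" and r: "1 \<le> r" "r \<le> d"
  shows "Rq_cong d q (qtransform q n (lstar_tail q d s t 0))
    (\<Sum>m\<in>desc_tuples (l r) n. block_prefix q l t n r (l r) m *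
      qtransform q (m (l r)) (lstar_tail q d s t r))"
proof -
  have d: "d \<ge> 1" using r by simp
  have mono: "mono l"
    unfolding l_def by (intro monoI sum_mono2) auto
  let ?h = "\<lambda>r i a. tconst (1 / qint q a ^ (s r - i)) * lstar_tail q d s t r a"
  have h: "?h r i k \<in> poly_carrier d" for r i k
    by (intro poly_carrier_closed lstar_tail_closed d t)
  \<comment> \<open>Since \<open>s (Suc r)\<close> is positive, one factor of the denominator can be
    used for the opening summation; exponent \<open>s (Suc r) - 1\<close> remains.\<close>
  have tail_Suc: "lstar_tail q d s t r (Suc k) = (if r = 0 then 1 else t r) * lstar_tail q d s t r k +
      tconst (1 / qint q (Suc k)) * ?h (Suc r) 1 (Suc k)" if "r < d" for r k
    using lstar_tail_Suc[OF that, of q s t k] s[of "Suc r"] that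
      tconst_inverse_power[of 0 "s (Suc r)" "qint q (Suc k)"]
    by (simp add: mult.assoc)
  \<comment> \<open>Both cases of the induction end this way: running from \<open>i = 1\<close> to
    \<open>i = s r\<close> brings the exponent of the denominator down to 0.\<close>
  have finish: "Rq_cong d q (qtransform q n (lstar_tail q d s t 0))
      (\<Sum>m\<in>desc_tuples (l r) n. block_prefix q l t n r (l r) m *
        qtransform q (m (l r)) (lstar_tail q d s t r))"
    if r: "1 \<le> r" "r \<le> d" and base: "Rq_cong d q (qtransform q n (lstar_tail q d s t 0))
      (\<Sum>m\<in>desc_tuples (l (r - 1) + 1) n. block_prefix q l t n r (l (r - 1) + 1) m *
        qtransform q (m (l (r - 1) + 1)) (?h r 1))" for r
  proof -
    have "l (r - 1) + s r = l r" using r by (cases r) (auto simp: l_def)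
    then show ?thesis
      using qtransform_lstar_within_block[OF mono q d t r _ order_refl base] s[of r] r
      by (simp add: tconst_hom)
  qed
  show ?thesis
    using r
  proof (induction r rule: dec_induct)
    case base
    have "Rq_cong d q (qtransform q n (lstar_tail q d s t 0))
      (\<Sum>a=1..n. fconst (tconst (1 / qint q a)) *
         ((fconst 1 * fletter LX + fletter LY) ^ (n - a) * qtransform q a (?h 1 1)))"
    proof (rule qtransform_step[OF q])
      show "lstar_tail q d s t 0 (Suc k) = 1 * lstar_tail q d s t 0 k +
          tconst (1 / qint q (Suc k)) * ?h 1 1 (Suc k)" for k
        using tail_Suc[of 0 k] d by simp
      show "lstar_tail q d s t 0 k \<in> poly_carrier d" for k
        by (intro lstar_tail_closed d t)
    qed (use h in \<open>auto simp: poly_carrier_closed lstar_tail_0\<close>)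
    \<comment> \<open>As \<open>l 0 = 0\<close>, the prefix consists only of 1/[n_1] and the power
      of \<open>x + y\<close>; the list is empty and the power of \<open>y\<close> is
      trivial.\<close>
    also have "\<dots> = (\<Sum>m\<in>desc_tuples (l (1 - 1) + 1) n. block_prefix q l t n 1 (l (1 - 1) + 1) m *
        qtransform q (m (l (1 - 1) + 1)) (?h 1 1))"
      unfolding sum_desc_tuples_1[symmetric]
      by (simp add: l_def block_prefix_def fconst_hom(2) mult.assoc)
    finally show ?case by (intro finish) (use d in auto)
  next
    case (step r)
    \<comment> \<open>Positivity of \<open>s r\<close> makes block \<open>r\<close> nonempty, as
      \<open>block_prefix_upd\<close> requires at \<open>N = l r\<close>.\<close>
    have lr: "l (r - 1) < l r"
      using s[of r] step by (cases r) (auto simp: l_def)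
    have "Rq_cong d q (qtransform q n (lstar_tail q d s t 0))
      (\<Sum>m\<in>desc_tuples (Suc (l r)) n. block_prefix q l t n r (l r) m *
        (fconst (tconst (1 / qint q (m (Suc (l r))))) *
         ((fconst (t r) * fletter LX + fletter LY) ^ (m (l r) - m (Suc (l r))) *
           qtransform q (m (Suc (l r))) (?h (Suc r) 1))))"
    proof (rule qtransform_desc_tuples_step[OF q])
      show "lstar_tail q d s t r (Suc k) = t r * lstar_tail q d s t r k +
          tconst (1 / qint q (Suc k)) * ?h (Suc r) 1 (Suc k)" for k
        using tail_Suc[of r k] step by simp
      show "lstar_tail q d s t r k \<in> poly_carrier d" for k
        by (intro lstar_tail_closed d t)
      show "block_prefix q l t n r (l r) (m(Suc (l r) := a)) = block_prefix q l t n r (l r) m" for m a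
        using lr mono by (intro block_prefix_upd)
      show "block_prefix q l t n r (l r) m \<in> carrier (free_alg d)" for m
        using step by (intro block_prefix_closed t) auto
    qed (use step h lr t in \<open>auto simp: lstar_tail_0\<close>)
    also have "\<dots> = (\<Sum>m\<in>desc_tuples (l (Suc r - 1) + 1) n.
        block_prefix q l t n (Suc r) (l (Suc r - 1) + 1) m *
        qtransform q (m (l (Suc r - 1) + 1)) (?h (Suc r) 1))"
      using step by (simp add: block_prefix_next_block mult.assoc)
    finally show ?case by (intro finish) (use step in auto)
  qed
qed

section \<open>Return to the quotient ring\<close>

text \<open>The additional term \<open>k = 0\<close> is zero because \<open>lstar\<close> vanishes
  there, and centrality moves the scalar from the right end of each summand to the left.\<close>

lemma Mq_eq_qtransform:
  assumes "d \<ge> 1" "\<And>i. i \<in> {1..d} \<Longrightarrow> t i \<in> poly_carrier d"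
  shows "Mq q d n s t (Rq_x d q) (Rq_y d q) =
    Rq_class d q (qtransform q n (lstar_tail q d s t 0))"
proof -
  let ?x = "fletter LX" and ?y = "fletter LY"
  let ?f = "\<lambda>k. fconst (tconst (qbinom q n k)) * ?x ^ k * ?y ^ (n - k) * fconst (lstar q d s t k)"
  have l0: "lstar q d s t 0 = 0"
    using lstar_tail_eq_lstar[OF assms(1)] by (metis lstar_tail_0)
  have l: "fconst (lstar q d s t k) \<in> carrier (free_alg d)" for k
    by (intro free_alg_closure lstar_closed assms)
  have "qtransform q n (lstar_tail q d s t 0) = (\<Sum>k=1..n. ?f k)"
    unfolding qtransform_def
    by (intro sum.mono_neutral_cong_right)
      (auto simp: l0 fconst_hom lstar_tail_eq_lstar[OF assms(1)] mult.assoc Suc_le_eq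
        fconst_central[of "lstar q d s t _"])
  moreover have "Rq_class d q (?f k) = Rq_scalar d q (tconst (qbinom q n k)) \<otimes>\<^bsub>Rq d q\<^esub>
       (Rq_x d q [^]\<^bsub>Rq d q\<^esub> k) \<otimes>\<^bsub>Rq d q\<^esub> (Rq_y d q [^]\<^bsub>Rq d q\<^esub> (n - k)) \<otimes>\<^bsub>Rq d q\<^esub>
       Rq_scalar d q (lstar q d s t k)" for k
    by (simp add: Rq_class_mult Rq_class_power l free_alg_closure Rq_scalar_def Rq_x_def Rq_y_def)
  moreover have "Rq_class d q (\<Sum>k=1..n. ?f k) = (\<Oplus>\<^bsub>Rq d q\<^esub>k\<in>{1..n}. Rq_class d q (?f k))"
    by (intro Rq_class_sum free_alg_closure l)
  ultimately show ?thesis by (simp only: Mq_def)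
qed

theorem theorem1p3:
  fixes q :: complex and d n :: nat and s :: "nat \<Rightarrow> nat"
  assumes "norm q \<noteq> 0" and "norm q \<noteq> 1"
    and "d \<ge> 1"
    and "\<forall>i\<in>{1..d}. s i > 0"
    and "n \<ge> 1"
  shows
   "let A = Rq d q;
        x = Rq_x d q;
        y = Rq_y d q;
        C = (\<lambda>c. Rq_scalar d q (tconst c));
        T = (\<lambda>r. Rq_scalar d q (tvar r));
        l = (\<lambda>i. \<Sum>j=1..i. s j);
        w = l d
    in Mq q d n s tvar x y =
      (\<Oplus>\<^bsub>A\<^esub>m\<in>desc_tuples w n.
         C (1 / (\<Prod>j=1..w. qint q (m j))) \<otimes>\<^bsub>A\<^esub>
         ((x \<oplus>\<^bsub>A\<^esub> y) [^]\<^bsub>A\<^esub> (n - m 1)) \<otimes>\<^bsub>A\<^esub>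
         ordered_prod A
           (map (\<lambda>r. (y [^]\<^bsub>A\<^esub> (m (l (r - 1) + 1) - m (l r))) \<otimes>\<^bsub>A\<^esub>
                     ((T r \<otimes>\<^bsub>A\<^esub> x \<oplus>\<^bsub>A\<^esub> y) [^]\<^bsub>A\<^esub> (m (l r) - m (l r + 1))))
                [1..<d]) \<otimes>\<^bsub>A\<^esub>
         (y [^]\<^bsub>A\<^esub> (m (l (d - 1) + 1) - m (l d))) \<otimes>\<^bsub>A\<^esub>
         (((T d \<otimes>\<^bsub>A\<^esub> x \<oplus>\<^bsub>A\<^esub> y) [^]\<^bsub>A\<^esub> m (l d)) \<ominus>\<^bsub>A\<^esub> (y [^]\<^bsub>A\<^esub> m (l d))))"
proof -
  define l where "l = (\<lambda>i. \<Sum>j=1..i. s j)"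
  let ?A = "Rq d q" and ?x = "Rq_x d q" and ?y = "Rq_y d q"
  let ?T = "\<lambda>r. Rq_scalar d q (tvar r)"
  let ?z = "\<lambda>r. fconst (tvar r) * fletter LX + fletter LY"
  let ?last = "\<lambda>m. ?z d ^ m (l d) - fletter LY ^ m (l d)"
  have t: "tvar i \<in> poly_carrier d" if "i \<in> {1..d}" for i
    using that by (rule poly_carrier_closed)
  have prefix: "block_prefix q l tvar n d (l d) m \<in> carrier (free_alg d)" for m
    by (intro block_prefix_closed t) auto
  have z: "?z r \<in> carrier (free_alg d)" if "r \<in> {1..d}" for r
    using that by (intro free_alg_closure)
  have last: "?last m \<in> carrier (free_alg d)" for m
    using assms(3) by (intro free_alg_closure z) auto
  have class_z: "Rq_class d q (?z r ^ k) = (?T r \<otimes>\<^bsub>?A\<^esub> ?x \<oplus>\<^bsub>?A\<^esub> ?y) [^]\<^bsub>?A\<^esub> k"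
    if "r \<in> {1..d}" for r k
    using z[OF that] t[OF that]
    by (simp add: Rq_class_power Rq_class_add Rq_class_mult free_alg_closure Rq_scalar_def
        Rq_x_def Rq_y_def)
  have class_y: "Rq_class d q (fletter LY ^ k) = ?y [^]\<^bsub>?A\<^esub> k" for k
    by (simp add: Rq_class_power free_alg_closure Rq_y_def)
  have class_xy: "Rq_class d q ((fletter LX + fletter LY) ^ k) = (?x \<oplus>\<^bsub>?A\<^esub> ?y) [^]\<^bsub>?A\<^esub> k" for k
    by (simp add: Rq_class_power Rq_class_add free_alg_closure Rq_x_def Rq_y_def)
  \<comment> \<open>After all \<open>w\<close> summations the function left is the one treated by
    \<open>qtransform_power_pos\<close>.\<close>
  have tail: "lstar_tail q d s tvar d = (\<lambda>k. if k = 0 then 0 else tvar d ^ k)"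
    by (subst lstar_tail.simps[abs_def]) simp
  have "Rq_cong d q (qtransform q n (lstar_tail q d s tvar 0))
      (\<Sum>m\<in>desc_tuples (l d) n. block_prefix q l tvar n d (l d) m *
        qtransform q (m (l d)) (lstar_tail q d s tvar d))"
    unfolding l_def using assms t by (intro qtransform_lstar_blocks) auto
  also have "Rq_cong d q \<dots> (\<Sum>m\<in>desc_tuples (l d) n. block_prefix q l tvar n d (l d) m * ?last m)"
    unfolding tail
    by (intro Rq_cong_sum Rq_cong_mult Rq_cong_refl prefix qtransform_power_pos assms(2) t)
      (use assms(3) in auto)
  finally have "Mq q d n s tvar ?x ?y =
      Rq_class d q (\<Sum>m\<in>desc_tuples (l d) n. block_prefix q l tvar n d (l d) m * ?last m)"
    using assms(3) t by (subst Mq_eq_qtransform) (auto simp: Rq_cong_def)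
  also have "\<dots> = (\<Oplus>\<^bsub>?A\<^esub>m\<in>desc_tuples (l d) n.
      Rq_class d q (block_prefix q l tvar n d (l d) m * ?last m))"
    by (intro Rq_class_sum free_alg_closure prefix last)
  \<comment> \<open>The summands agree for every function \<open>m\<close>, not only for tuples:
    exponents are natural numbers, so all factors lie in the carrier.\<close>
  also have "(\<lambda>m. Rq_class d q (block_prefix q l tvar n d (l d) m * ?last m)) =
      (\<lambda>m. Rq_scalar d q (tconst (1 / (\<Prod>j=1..l d. qint q (m j)))) \<otimes>\<^bsub>?A\<^esub>
         ((?x \<oplus>\<^bsub>?A\<^esub> ?y) [^]\<^bsub>?A\<^esub> (n - m 1)) \<otimes>\<^bsub>?A\<^esub>
         ordered_prod ?A
           (map (\<lambda>r. (?y [^]\<^bsub>?A\<^esub> (m (l (r - 1) + 1) - m (l r))) \<otimes>\<^bsub>?A\<^esub>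
                     ((?T r \<otimes>\<^bsub>?A\<^esub> ?x \<oplus>\<^bsub>?A\<^esub> ?y) [^]\<^bsub>?A\<^esub> (m (l r) - m (l r + 1))))
                [1..<d]) \<otimes>\<^bsub>?A\<^esub>
         (?y [^]\<^bsub>?A\<^esub> (m (l (d - 1) + 1) - m (l d))) \<otimes>\<^bsub>?A\<^esub>
         (((?T d \<otimes>\<^bsub>?A\<^esub> ?x \<oplus>\<^bsub>?A\<^esub> ?y) [^]\<^bsub>?A\<^esub> m (l d)) \<ominus>\<^bsub>?A\<^esub> (?y [^]\<^bsub>?A\<^esub> m (l d))))"
  proof
    fix m
    let ?B = "\<lambda>r. fletter LY ^ (m (l (r - 1) + 1) - m (l r)) * ?z r ^ (m (l r) - m (l r + 1))"
    have B: "?B r \<in> carrier (free_alg d)" if "r \<in> set [1..<d]" for r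
      using that by (intro free_alg_closure) auto
    have class_B: "Rq_class d q (prod_list (map ?B [1..<d])) = ordered_prod ?A
        (map (\<lambda>r. (?y [^]\<^bsub>?A\<^esub> (m (l (r - 1) + 1) - m (l r))) \<otimes>\<^bsub>?A\<^esub>
          ((?T r \<otimes>\<^bsub>?A\<^esub> ?x \<oplus>\<^bsub>?A\<^esub> ?y) [^]\<^bsub>?A\<^esub> (m (l r) - m (l r + 1)))) [1..<d])"
    proof (subst Rq_class_prod_list[OF B], assumption,
        intro arg_cong[where f = "ordered_prod ?A"] map_cong refl)
      fix r assume "r \<in> set [1..<d]"
      then have r: "r \<in> {1..d}" by simp
      show "Rq_class d q (?B r) = (?y [^]\<^bsub>?A\<^esub> (m (l (r - 1) + 1) - m (l r))) \<otimes>\<^bsub>?A\<^esub>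
          ((?T r \<otimes>\<^bsub>?A\<^esub> ?x \<oplus>\<^bsub>?A\<^esub> ?y) [^]\<^bsub>?A\<^esub> (m (l r) - m (l r + 1)))"
        unfolding class_z[OF r, symmetric] class_y[symmetric]
        by (intro Rq_class_mult free_alg_closure z[OF r])
    qed
    have prod: "prod_list (map ?B [1..<d]) \<in> carrier (free_alg d)"
      by (rule free_alg_prod_list_closed) (use B in auto)
    have d: "d \<in> {1..d}" using assms(3) by simp
    have "Rq_class d q (block_prefix q l tvar n d (l d) m * ?last m) =
        Rq_class d q (fconst (tconst (1 / (\<Prod>j=1..l d. qint q (m j))))) \<otimes>\<^bsub>?A\<^esub>
        Rq_class d q ((fletter LX + fletter LY) ^ (n - m 1)) \<otimes>\<^bsub>?A\<^esub>
        Rq_class d q (prod_list (map ?B [1..<d])) \<otimes>\<^bsub>?A\<^esub>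
        Rq_class d q (fletter LY ^ (m (l (d - 1) + 1) - m (l d))) \<otimes>\<^bsub>?A\<^esub>
        (Rq_class d q (?z d ^ m (l d)) \<ominus>\<^bsub>?A\<^esub> Rq_class d q (fletter LY ^ m (l d)))"
      unfolding block_prefix_def using prod last[of m] z[OF d]
      by (simp add: Rq_class_mult Rq_class_diff free_alg_closure del: One_nat_def)
    then show "Rq_class d q (block_prefix q l tvar n d (l d) m * ?last m) =
       Rq_scalar d q (tconst (1 / (\<Prod>j=1..l d. qint q (m j)))) \<otimes>\<^bsub>?A\<^esub>
         ((?x \<oplus>\<^bsub>?A\<^esub> ?y) [^]\<^bsub>?A\<^esub> (n - m 1)) \<otimes>\<^bsub>?A\<^esub>
         ordered_prod ?A
           (map (\<lambda>r. (?y [^]\<^bsub>?A\<^esub> (m (l (r - 1) + 1) - m (l r))) \<otimes>\<^bsub>?A\<^esub>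
                     ((?T r \<otimes>\<^bsub>?A\<^esub> ?x \<oplus>\<^bsub>?A\<^esub> ?y) [^]\<^bsub>?A\<^esub> (m (l r) - m (l r + 1))))
                [1..<d]) \<otimes>\<^bsub>?A\<^esub>
         (?y [^]\<^bsub>?A\<^esub> (m (l (d - 1) + 1) - m (l d))) \<otimes>\<^bsub>?A\<^esub>
         (((?T d \<otimes>\<^bsub>?A\<^esub> ?x \<oplus>\<^bsub>?A\<^esub> ?y) [^]\<^bsub>?A\<^esub> m (l d)) \<ominus>\<^bsub>?A\<^esub> (?y [^]\<^bsub>?A\<^esub> m (l d)))"
      by (simp only: class_B class_z[OF d] class_y class_xy Rq_scalar_def)
  qed
  finally show ?thesis
    unfolding l_def Let_def .
qed

end
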